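(* Let $\mathcal{M}\subseteq\mathbb{Z}^{n_1}\times\mathbb{R}^{n_2}$ be a monoid under addition, and let $c\in\mathbb{R}^{n_1}$, $d\in\mathbb{R}^{n_2}$, $A\in\mathbb{R}^{m\times n_1}$, $G\in\mathbb{R}^{m\times n_2}$, $b\in\mathbb{R}^m$. Assume that the mixed-integer program $$z^*=\inf\{c^Tx+d^Ty : Ax+Gy=b,\ (x,y)\in\mathcal{M}\}$$ is feasible, and consider its subadditive dual over functions on $\Omega^\leq$, $$\rho^*=\sup\{f(b) : f(Au+Gv)\le c^Tu+d^Tv\ \text{for all }(u,v)\in\mathcal{I}(\mathcal{M}),\ f(0)=0,\ f:\Omega^\leq\to\mathbb{R}\text{ subadditive}\},$$ where $\mathcal{I}(\mathcal{M})$ is an integral generating set of $\mathcal{M}$. Assume that: (i) for every $\alpha\in\mathbb{R}^m$ the generator subadditive function $F_\alpha:\Omega^\leq\to\mathbb{R}$ is well-defined, i.e. $F_\alpha(\omega)>-\infty$ for all $\omega\in\Omega^\leq$; (ii) $\mathrm{conv}(\mathcal{M}^\leq(b))$ is conic representable, i.e. $$\mathrm{conv}(\mathcal{M}^\leq(b))=\{(x,y)\in\mathbb{R}^{n_1}\times\mathbb{R}^{n_2}:\exists\,w\in\mathbb{R}^{n_3}\text{ s.t. }\Pi x+\Phi y+\Psi w\succeq_C\pi\}$$ for some matrices $\Pi,\Phi,\Psi$, a vector $\pi$ and a regular cone $C$; (iii) the conic dual of $\inf\{c^Tx+d^Ty: Ax+Gy=b,\ \Pi x+\Phi y+\Psi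 w\succeq_C\pi\}$ is a strong dual. Then there exists $\alpha^*\in\mathbb{R}^m$ such that $F_{\alpha^*}:\Omega^\leq\to\mathbb{R}$ is well-defined and is an optimal solution to the subadditive dual.
   Context: A monoid $\mathcal{M}$ (under $+$) contains $0$ and is closed under addition. An integral generating set of $\mathcal{M}$ is a set $\mathcal{I}(\mathcal{M})\subseteq\mathcal{M}$ such that every $w\in\mathcal{M}$ can be written as $w=\sum_{i=1}^p\lambda_ih_i$ with $h_i\in\mathcal{I}(\mathcal{M})$ and $\lambda_i\in\mathbb{Z}_+$. Define $\Omega^\leq=\{\omega\in\mathbb{R}^m: Ax+Gy\le\omega\text{ for some }(x,y)\in\mathcal{M}\}$ and, for $\omega\in\Omega^\leq$, $\mathcal{M}^\leq(\omega)=\{(x,y)\in\mathcal{M}: Ax+Gy\le\omega\}$ (componentwise inequalities). For $\alpha\in\mathbb{R}^m$, the generator subadditive function $F_\alpha:\Omega^\leq\to\mathbb{R}\cup\{-\infty\}$ is $$F_\alpha(\omega)=\alpha^T\omega-\sup\{(A^T\alpha-c)^Tx+(G^T\alpha-d)^Ty : (x,y)\in\mathcal{M}^\leq(\omega)\}.$$ A function $f:\mathcal{D}\to\mathbb{R}$ is subadditive if $f(u+v)\le f(u)+f(v)$ for all $u,v\in\mathcal{D}$ with $u+v\in\mathcal{D}$. A cone $C$ is regular if it is closed, convex, pointed and full-dimensional; $x\succeq_C y$ means $x-y\in C$; the dual cone is $C_*=\{y: x^Ty\ge0\text{ for all }x\in C\}$. The conic dual in (iii) is $$\sup\{b^T\alpha+\pi^T\gamma: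 A^T\alpha+\Pi^T\gamma=c,\ G^T\alpha+\Phi^T\gamma=d,\ \Psi^T\gamma=0,\ \gamma\in C_*\}.$$ A dual problem is a strong dual if its optimal value equals the optimal value of the primal problem and the dual is solvable, i.e. its optimal value is attained. *)

theory Defs
  imports "HOL-Analysis.Analysis"
begin

definition add_submonoid :: "'a::monoid_add set \<Rightarrow> bool" where
  "add_submonoid M \<longleftrightarrow> 0 \<in> M \<and> (\<forall>u\<in>M. \<forall>v\<in>M. u + v \<in> M)"

definition integral_generating_set :: "'a::real_vector set \<Rightarrow> 'a set \<Rightarrow> bool" where
  "integral_generating_set I M \<longleftrightarrow>
     I \<subseteq> M \<and>
     (\<forall>w\<in>M. \<exists>(p::nat) (h :: nat \<Rightarrow> 'a) (l :: nat \<Rightarrow> nat).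
        (\<forall>i\<in>{1..p}. h i \<in> I) \<and> w = (\<Sum>i=1..p. real (l i) *\<^sub>R h i))"

definition subadditive_on :: "'a::plus set \<Rightarrow> ('a \<Rightarrow> real) \<Rightarrow> bool" where
  "subadditive_on D f \<longleftrightarrow> (\<forall>u\<in>D. \<forall>v\<in>D. u + v \<in> D \<longrightarrow> f (u + v) \<le> f u + f v)"

definition regular_cone :: "'a::euclidean_space set \<Rightarrow> bool" where
  "regular_cone C \<longleftrightarrow>
     cone C \<and> closed C \<and> convex C \<and>
     (\<forall>x. x \<in> C \<and> - x \<in> C \<longrightarrow> x = 0) \<and>
     aff_dim C = int DIM('a)"

definition dual_cone :: "'a::real_inner set \<Rightarrow> 'a set" where
  "dual_cone C = {y. \<forall>x\<in>C. x \<bullet> y \<ge> 0}"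

text \<open>
  Optimal values live in the extended reals, so infeasible and unbounded problems are covered.
\<close>

definition inf_value :: "('a \<Rightarrow> real) \<Rightarrow> 'a set \<Rightarrow> ereal" where
  "inf_value f S = (INF z\<in>S. ereal (f z))"

definition sup_value :: "('a \<Rightarrow> real) \<Rightarrow> 'a set \<Rightarrow> ereal" where
  "sup_value f S = (SUP z\<in>S. ereal (f z))"

definition optimal_max_solution :: "('a \<Rightarrow> real) \<Rightarrow> 'a set \<Rightarrow> 'a \<Rightarrow> bool" where
  "optimal_max_solution f S z \<longleftrightarrow> z \<in> S \<and> ereal (f z) = sup_value f S"

text \<open>
  The primal problem minimises \<open>p\<close> over \<open>P\<close>, its dual maximises \<open>q\<close> over \<open>D\<close>.
\<close>

definition strong_dual :: "('a \<Rightarrow> real) \<Rightarrow> 'a set \<Rightarrow> ('b \<Rightarrow> real) \<Rightarrow> 'b set \<Rightarrow> bool" where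
  "strong_dual p P q D \<longleftrightarrow>
     sup_value q D = inf_value p P \<and> (\<exists>z. optimal_max_solution q D z)"

definition mip_feasible ::
  "real^'n1^'m \<Rightarrow> real^'n2^'m \<Rightarrow> real^'m \<Rightarrow> ((real^'n1) \<times> (real^'n2)) set
    \<Rightarrow> ((real^'n1) \<times> (real^'n2)) set" where
  "mip_feasible A G b M = {(x, y). (x, y) \<in> M \<and> A *v x + G *v y = b}"

text \<open>The order on \<^typ>\<open>real^'m\<close> is the componentwise one.\<close>

definition M_le ::
  "real^'n1^'m \<Rightarrow> real^'n2^'m \<Rightarrow> ((real^'n1) \<times> (real^'n2)) set \<Rightarrow> real^'m
    \<Rightarrow> ((real^'n1) \<times> (real^'n2)) set" where
  "M_le A G M \<omega> = {(x, y). (x, y) \<in> M \<and> A *v x + G *v y \<le> \<omega>}"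

definition Omega_le ::
  "real^'n1^'m \<Rightarrow> real^'n2^'m \<Rightarrow> ((real^'n1) \<times> (real^'n2)) set \<Rightarrow> (real^'m) set" where
  "Omega_le A G M = {\<omega>. \<exists>(x, y)\<in>M. A *v x + G *v y \<le> \<omega>}"

text \<open>
  Only the values on \<^term>\<open>Omega_le A G M\<close> are meaningful; there the supremum ranges over a
  nonempty set, so the value is a real number or \<open>-\<infinity>\<close>.
\<close>

definition generator_fun ::
  "real^'n1^'m \<Rightarrow> real^'n2^'m \<Rightarrow> real^'n1 \<Rightarrow> real^'n2 \<Rightarrow> ((real^'n1) \<times> (real^'n2)) set
    \<Rightarrow> real^'m \<Rightarrow> real^'m \<Rightarrow> ereal" where
  "generator_fun A G c d M \<alpha> \<omega> =
     ereal (\<alpha> \<bullet> \<omega>) -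
     (SUP (x, y)\<in>M_le A G M \<omega>.
        ereal ((transpose A *v \<alpha> - c) \<bullet> x + (transpose G *v \<alpha> - d) \<bullet> y))"

definition generator_well_defined ::
  "real^'n1^'m \<Rightarrow> real^'n2^'m \<Rightarrow> real^'n1 \<Rightarrow> real^'n2 \<Rightarrow> ((real^'n1) \<times> (real^'n2)) set
    \<Rightarrow> real^'m \<Rightarrow> bool" where
  "generator_well_defined A G c d M \<alpha> \<longleftrightarrow>
     (\<forall>\<omega>\<in>Omega_le A G M. generator_fun A G c d M \<alpha> \<omega> > -\<infinity>)"

text \<open>
  Functions on \<^term>\<open>Omega_le A G M\<close> are represented by total functions. All constraints, and the
  objective \<open>f b\<close> of a feasible program, only concern arguments in \<^term>\<open>Omega_le A G M\<close>.
\<close>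

definition subadditive_dual_feasible ::
  "real^'n1^'m \<Rightarrow> real^'n2^'m \<Rightarrow> real^'n1 \<Rightarrow> real^'n2 \<Rightarrow> ((real^'n1) \<times> (real^'n2)) set
    \<Rightarrow> ((real^'n1) \<times> (real^'n2)) set \<Rightarrow> (real^'m \<Rightarrow> real) set" where
  "subadditive_dual_feasible A G c d M I =
     {f. (\<forall>(u, v)\<in>I. f (A *v u + G *v v) \<le> c \<bullet> u + d \<bullet> v) \<and>
         f 0 = 0 \<and> subadditive_on (Omega_le A G M) f}"

definition conic_set ::
  "real^'n1^'k \<Rightarrow> real^'n2^'k \<Rightarrow> real^'n3^'k \<Rightarrow> real^'k \<Rightarrow> (real^'k) set
    \<Rightarrow> ((real^'n1) \<times> (real^'n2) \<times> (real^'n3)) set" where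
  "conic_set P \<Phi> \<Psi> \<pi> C = {(x, y, w). P *v x + \<Phi> *v y + \<Psi> *v w - \<pi> \<in> C}"

definition conic_primal_feasible ::
  "real^'n1^'m \<Rightarrow> real^'n2^'m \<Rightarrow> real^'m
    \<Rightarrow> real^'n1^'k \<Rightarrow> real^'n2^'k \<Rightarrow> real^'n3^'k \<Rightarrow> real^'k \<Rightarrow> (real^'k) set
    \<Rightarrow> ((real^'n1) \<times> (real^'n2) \<times> (real^'n3)) set" where
  "conic_primal_feasible A G b P \<Phi> \<Psi> \<pi> C =
     {(x, y, w). A *v x + G *v y = b \<and> (x, y, w) \<in> conic_set P \<Phi> \<Psi> \<pi> C}"

definition conic_dual_feasible ::
  "real^'n1^'m \<Rightarrow> real^'n2^'m \<Rightarrow> real^'n1 \<Rightarrow> real^'n2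
    \<Rightarrow> real^'n1^'k \<Rightarrow> real^'n2^'k \<Rightarrow> real^'n3^'k \<Rightarrow> (real^'k) set
    \<Rightarrow> ((real^'m) \<times> (real^'k)) set" where
  "conic_dual_feasible A G c d P \<Phi> \<Psi> C =
     {(\<alpha>, \<gamma>). transpose A *v \<alpha> + transpose P *v \<gamma> = c \<and>
              transpose G *v \<alpha> + transpose \<Phi> *v \<gamma> = d \<and>
              transpose \<Psi> *v \<gamma> = 0 \<and> \<gamma> \<in> dual_cone C}"

end

theory Submission
  imports Defs
begin

text \<open>
  Let \<open>(\<alpha>, \<gamma>)\<close> be optimal for the conic dual. Since \<open>A\<^sup>T\<alpha> - c = - \<Pi>\<^sup>T\<gamma>\<close> and \<open>G\<^sup>T\<alpha> - d = - \<Phi>\<^sup>T\<gamma>\<close>,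
  the supremum in \<open>F\<^sub>\<alpha> b\<close> is taken over \<open>- \<gamma> \<bullet> (\<Pi>x + \<Phi>y + \<Psi>w) \<le> - \<gamma> \<bullet> \<pi>\<close>, so
  \<open>F\<^sub>\<alpha> b \<ge> b \<bullet> \<alpha> + \<pi> \<bullet> \<gamma>\<close>, the conic primal value.
  Conversely every feasible \<open>f\<close> of the subadditive dual has \<open>f b \<le> z\<^sup>*\<close>, and the conic
  primal value is not smaller than \<open>z\<^sup>*\<close>: the equations \<open>Ax + Gy = b\<close> cut out a face of the
  convex hull of \<open>M\<^sup>\<le>(b)\<close>, so a point of the hull satisfying them is a combination of feasible points of
  the mixed-integer program.
\<close>

section \<open>Faces of a convex hull\<close>

text \<open>A proper convex combination of two values at most \<open>b\<close> equals
  \<open>b\<close> only if both do. Hence \<open>?Q\<close> is convex, and minimality of the hull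
  replaces an induction on its points.\<close>

lemma convex_hull_equality_face:
  fixes T :: "'a::real_vector \<Rightarrow> 'b::ordered_real_vector"
  assumes "linear T" and z: "z \<in> convex hull {z \<in> S. T z \<le> b}" and "T z = b"
  shows "z \<in> convex hull {z \<in> S. T z = b}"
proof -
  interpret linear T by fact
  let ?K = "convex hull {z \<in> S. T z = b}"
  let ?Q = "{z. T z \<le> b \<and> (T z = b \<longrightarrow> z \<in> ?K)}"
  \<comment> \<open>The order may be partial, so strict inequalities are avoided: bounding
    \<open>q\<close> by \<open>b\<close> leaves \<open>u *\<^sub>R b \<le> u *\<^sub>R p\<close>,
    then \<open>u\<close> cancels and antisymmetry concludes.\<close>
  have eq_left: "p = b"
    if "p \<le> b" "q \<le> b" "0 < u" "0 \<le> v" "u + v = 1" "u *\<^sub>R p + v *\<^sub>R q = b"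
    for p q :: 'b and u v :: real
  proof -
    have "v *\<^sub>R q \<le> v *\<^sub>R b" using that by (intro scaleR_left_mono) auto
    moreover have "u *\<^sub>R b + v *\<^sub>R b = b" using that by (simp flip: scaleR_add_left)
    ultimately have "u *\<^sub>R b \<le> u *\<^sub>R p" using that(6)
      by (metis add_le_cancel_left add_le_cancel_right add.commute order_refl)
    then have "b \<le> p" using \<open>0 < u\<close> by (simp add: scaleR_le_cancel_left_pos)
    then show ?thesis using \<open>p \<le> b\<close> by simp
  qed
  have "convex ?Q"
  proof (rule convexI)
    fix x y and u v :: real
    assume x: "x \<in> ?Q" and y: "y \<in> ?Q" and uv: "0 \<le> u" "0 \<le> v" "u + v = 1"
    have T: "T (u *\<^sub>R x + v *\<^sub>R y) = u *\<^sub>R T x + v *\<^sub>R T y" by (simp add: add scale)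
    have "u *\<^sub>R T x + v *\<^sub>R T y \<le> u *\<^sub>R b + v *\<^sub>R b"
      using x y uv by (intro add_mono scaleR_left_mono) auto
    also have "\<dots> = b" using uv by (simp flip: scaleR_add_left)
    finally have le: "T (u *\<^sub>R x + v *\<^sub>R y) \<le> b" unfolding T .
    have "u *\<^sub>R x + v *\<^sub>R y \<in> ?K" if eq: "T (u *\<^sub>R x + v *\<^sub>R y) = b"
    proof (cases "u = 0 \<or> v = 0")
      \<comment> \<open>The combination is then one of the endpoints; \<open>eq_left\<close> could
        not cancel a zero weight.\<close>
      case True
      then show ?thesis using x y uv eq by auto
    next
      case False
      then have "0 < u" "0 < v" using uv by auto
      then have "T x = b" "T y = b"
        using eq_left[of "T x" "T y" u v] eq_left[of "T y" "T x" v u] x y uv eq T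
        by (auto simp: add.commute)
      then show ?thesis using x y uv by (intro convexD convex_convex_hull) auto
    qed
    with le show "u *\<^sub>R x + v *\<^sub>R y \<in> ?Q" by blast
  qed
  moreover have "{z \<in> S. T z \<le> b} \<subseteq> ?Q" by (auto intro: hull_inc)
  ultimately have "z \<in> ?Q" using z hull_minimal by blast
  then show ?thesis using \<open>T z = b\<close> by blast
qed

section \<open>Weak duality from a generating set\<close>

text \<open>Subadditivity of \<open>f\<close> and linearity of \<open>T\<close> and \<open>L\<close>
  make \<open>?R\<close> closed under addition; it contains 0 and \<open>I\<close>, hence all
  nonnegative integer combinations of \<open>I\<close>. At points with \<open>T w = b\<close> this
  is weak duality.\<close>

lemma integral_generating_set_subadditive_le:
  fixes T :: "'a::real_vector \<Rightarrow> 'b::real_vector"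
  assumes M: "add_submonoid M" and I: "integral_generating_set I M"
    and T: "linear T" and L: "linear L"
    and D: "T ` M \<subseteq> D" and f: "subadditive_on D f" "f 0 \<le> 0"
    and le: "\<And>u. u \<in> I \<Longrightarrow> f (T u) \<le> L u" and w: "w \<in> M"
  shows "f (T w) \<le> L w"
proof -
  let ?R = "{w \<in> M. f (T w) \<le> L w}"
  have zero: "0 \<in> ?R"
    using M f by (simp add: add_submonoid_def linear_0[OF T] linear_0[OF L])
  have add: "u + v \<in> ?R" if "u \<in> ?R" "v \<in> ?R" for u v
  proof -
    have uv: "u + v \<in> M" using M that by (auto simp: add_submonoid_def)
    then have "T u + T v \<in> D" using D by (auto simp flip: linear_add[OF T])
    moreover have "T u \<in> D" "T v \<in> D" using D that by auto
    ultimately have "f (T u + T v) \<le> f (T u) + f (T v)"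
      using f(1) unfolding subadditive_on_def by blast
    then show ?thesis using uv that by (simp add: linear_add[OF T] linear_add[OF L])
  qed
  have multiple: "real k *\<^sub>R u \<in> ?R" if "u \<in> I" for k u
  proof (induction k)
    case 0
    then show ?case using zero by simp
  next
    case (Suc k)
    have "u \<in> ?R" using that I le by (auto simp: integral_generating_set_def)
    from add[OF this Suc] show ?case by (simp add: scaleR_add_left)
  qed
  obtain p h l where h: "\<And>i. i \<in> {1..p::nat} \<Longrightarrow> h i \<in> I"
    and w_eq: "w = (\<Sum>i=1..p. real (l i) *\<^sub>R h i)"
    using I w unfolding integral_generating_set_def by blast
  \<comment> \<open>Generalised to subsets \<open>J\<close> for the induction; they stay inside
    \<open>{1..p}\<close>, where \<open>h\<close> is known to take values in
    \<open>I\<close>.\<close>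
  have "(\<Sum>i\<in>J. real (l i) *\<^sub>R h i) \<in> ?R" if "finite J" "J \<subseteq> {1..p}" for J
    using that
  proof (induction J rule: finite_induct)
    case empty
    then show ?case using zero by simp
  next
    case (insert j J)
    then show ?case using add multiple h by simp
  qed
  from this[of "{1..p}"] show ?thesis by (simp add: w_eq)
qed

section \<open>The generator function as a real infimum\<close>

text \<open>Nonemptiness excludes the value -\<infinity>, so the supremum is real and the rules for
  bounded real suprema apply.\<close>

lemma SUP_ereal_finite_imp_bdd:
  fixes g :: "'a \<Rightarrow> real"
  assumes "S \<noteq> {}" and "(SUP z\<in>S. ereal (g z)) < \<infinity>"
  shows "bdd_above (g ` S)" "(SUP z\<in>S. ereal (g z)) = ereal (SUP z\<in>S. g z)"
proof -
  obtain z where "z \<in> S" using assms by blast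
  then have "ereal (g z) \<le> (SUP z\<in>S. ereal (g z))" by (rule SUP_upper)
  then obtain r where r: "(SUP z\<in>S. ereal (g z)) = ereal r"
    using assms by (cases "SUP z\<in>S. ereal (g z)") auto
  have "g z \<le> r" if "z \<in> S" for z
    using SUP_upper[OF that, of "\<lambda>z. ereal (g z)"] r by simp
  then show "bdd_above (g ` S)" by (rule bdd_aboveI2)
  then show "(SUP z\<in>S. ereal (g z)) = ereal (SUP z\<in>S. g z)"
    using assms r by (subst ereal_SUP) auto
qed

text \<open>Together the two facts characterise the value as a greatest lower bound over
  \<open>M_le A G M \<omega>\<close>; later arguments need no extended reals. The value is finite
  here, so \<open>real_of_ereal\<close> does not fall back to its default 0.\<close>

lemma
  assumes "generator_well_defined A G c d M \<alpha>" and "\<omega> \<in> Omega_le A G M"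
  shows generator_fun_le: "(x, y) \<in> M_le A G M \<omega> \<Longrightarrow>
      real_of_ereal (generator_fun A G c d M \<alpha> \<omega>)
        \<le> \<alpha> \<bullet> \<omega> - ((transpose A *v \<alpha> - c) \<bullet> x + (transpose G *v \<alpha> - d) \<bullet> y)"
    and generator_fun_ge:
      "(\<And>x y. (x, y) \<in> M_le A G M \<omega> \<Longrightarrow>
          t \<le> \<alpha> \<bullet> \<omega> - ((transpose A *v \<alpha> - c) \<bullet> x + (transpose G *v \<alpha> - d) \<bullet> y)) \<Longrightarrow>
        t \<le> real_of_ereal (generator_fun A G c d M \<alpha> \<omega>)"
proof -
  define g where "g = (\<lambda>(x, y). (transpose A *v \<alpha> - c) \<bullet> x + (transpose G *v \<alpha> - d) \<bullet> y)"
  have F: "generator_fun A G c d M \<alpha> \<omega> = ereal (\<alpha> \<bullet> \<omega>) - (SUP z\<in>M_le A G M \<omega>. ereal (g z))"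
    by (simp add: generator_fun_def g_def case_prod_unfold)
  have ne: "M_le A G M \<omega> \<noteq> {}" using assms(2) by (auto simp: Omega_le_def M_le_def)
  \<comment> \<open>A difference with real minuend exceeds -\<infinity> only if the subtracted
    supremum is below \<infinity>.\<close>
  have "(SUP z\<in>M_le A G M \<omega>. ereal (g z)) < \<infinity>"
    using assms F by (force simp: generator_well_defined_def)
  note fin = SUP_ereal_finite_imp_bdd[OF ne this]
  have F': "real_of_ereal (generator_fun A G c d M \<alpha> \<omega>) = \<alpha> \<bullet> \<omega> - (SUP z\<in>M_le A G M \<omega>. g z)"
    unfolding F fin(2) by simp
  show "real_of_ereal (generator_fun A G c d M \<alpha> \<omega>)
      \<le> \<alpha> \<bullet> \<omega> - ((transpose A *v \<alpha> - c) \<bullet> x + (transpose G *v \<alpha> - d) \<bullet> y)"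
    if "(x, y) \<in> M_le A G M \<omega>"
    using cSUP_upper[OF that fin(1)] by (simp add: F' g_def)
  show "t \<le> real_of_ereal (generator_fun A G c d M \<alpha> \<omega>)"
    if t: "\<And>x y. (x, y) \<in> M_le A G M \<omega> \<Longrightarrow>
        t \<le> \<alpha> \<bullet> \<omega> - ((transpose A *v \<alpha> - c) \<bullet> x + (transpose G *v \<alpha> - d) \<bullet> y)"
  proof -
    have "g z \<le> \<alpha> \<bullet> \<omega> - t" if "z \<in> M_le A G M \<omega>" for z
      using that t[of "fst z" "snd z"] by (simp add: g_def case_prod_unfold)
    then have "(SUP z\<in>M_le A G M \<omega>. g z) \<le> \<alpha> \<bullet> \<omega> - t" by (intro cSUP_least ne) auto
    then show ?thesis by (simp add: F')
  qed
qed

section \<open>Dual feasibility of the generator function\<close>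

lemma M_le_add:
  assumes "add_submonoid M" and "(x, y) \<in> M_le A G M u" and "(x', y') \<in> M_le A G M v"
  shows "(x + x', y + y') \<in> M_le A G M (u + v)"
proof -
  have "(x, y) + (x', y') \<in> M"
    using assms unfolding add_submonoid_def M_le_def by blast
  moreover have "(A *v x + G *v y) + (A *v x' + G *v y') \<le> u + v"
    using assms by (intro add_mono) (auto simp: M_le_def)
  ultimately show ?thesis by (simp add: M_le_def matrix_vector_right_distrib algebra_simps)
qed

lemma M_le_zero: "add_submonoid M \<Longrightarrow> 0 \<in> M_le A G M 0"
  by (simp add: add_submonoid_def M_le_def zero_prod_def)

lemma Omega_le_eq: "Omega_le A G M = {\<omega>. M_le A G M \<omega> \<noteq> {}}"
  by (auto simp: Omega_le_def M_le_def)

text \<open>Adding a competitor for \<open>u\<close> to one for \<open>v\<close> gives a competitor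
  for \<open>u + v\<close> whose value is the sum. The two infima are then taken one after the
  other, first over \<open>v\<close> with the point for \<open>u\<close> fixed.\<close>

lemma generator_fun_subadditive:
  assumes "add_submonoid M" and wd: "generator_well_defined A G c d M \<alpha>"
  shows "subadditive_on (Omega_le A G M) (\<lambda>\<omega>. real_of_ereal (generator_fun A G c d M \<alpha> \<omega>))"
  unfolding subadditive_on_def
proof (intro ballI impI)
  fix u v assume u: "u \<in> Omega_le A G M" and v: "v \<in> Omega_le A G M"
    and uv: "u + v \<in> Omega_le A G M"
  define F where "F \<omega> = real_of_ereal (generator_fun A G c d M \<alpha> \<omega>)" for \<omega>
  have "F (u + v) - F v \<le> F u"
    unfolding F_def[of u]
  proof (rule generator_fun_ge[OF wd u])
    fix x y assume xy: "(x, y) \<in> M_le A G M u"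
    have "F (u + v) - (\<alpha> \<bullet> u - ((transpose A *v \<alpha> - c) \<bullet> x + (transpose G *v \<alpha> - d) \<bullet> y)) \<le> F v"
      unfolding F_def[of v]
    proof (rule generator_fun_ge[OF wd v])
      fix x' y' assume "(x', y') \<in> M_le A G M v"
      from generator_fun_le[OF wd uv M_le_add[OF assms(1) xy this]]
      show "F (u + v) - (\<alpha> \<bullet> u - ((transpose A *v \<alpha> - c) \<bullet> x + (transpose G *v \<alpha> - d) \<bullet> y))
          \<le> \<alpha> \<bullet> v - ((transpose A *v \<alpha> - c) \<bullet> x' + (transpose G *v \<alpha> - d) \<bullet> y')"
        by (simp add: F_def inner_add_right)
    qed
    then show "F (u + v) - F v
        \<le> \<alpha> \<bullet> u - ((transpose A *v \<alpha> - c) \<bullet> x + (transpose G *v \<alpha> - d) \<bullet> y)"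
      by simp
  qed
  then show "real_of_ereal (generator_fun A G c d M \<alpha> (u + v))
      \<le> real_of_ereal (generator_fun A G c d M \<alpha> u) + real_of_ereal (generator_fun A G c d M \<alpha> v)"
    by (simp add: F_def)
qed

text \<open>
  \<open>M_le A G M 0\<close> is itself a monoid, so a positive value of the linear objective on it would
  make the supremum infinite.
\<close>

lemma generator_fun_zero:
  assumes M: "add_submonoid M" and wd: "generator_well_defined A G c d M \<alpha>"
  shows "real_of_ereal (generator_fun A G c d M \<alpha> 0) = 0" (is "?F = 0")
proof (rule antisym)
  have 0: "0 \<in> Omega_le A G M" using M_le_zero[OF M] by (auto simp: Omega_le_eq)
  show "?F \<le> 0"
    using generator_fun_le[OF wd 0 M_le_zero[OF M, unfolded zero_prod_def]] by simp
  show "0 \<le> ?F"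
  proof (rule generator_fun_ge[OF wd 0])
    fix x y assume xy: "(x, y) \<in> M_le A G M 0"
    let ?r = "(transpose A *v \<alpha> - c) \<bullet> x + (transpose G *v \<alpha> - d) \<bullet> y"
    have "(real k *\<^sub>R x, real k *\<^sub>R y) \<in> M_le A G M 0" for k
    proof (induction k)
      case 0
      then show ?case using M_le_zero[OF M] by (simp add: zero_prod_def)
    next
      case (Suc k)
      from M_le_add[OF M xy this] show ?case by (simp add: scaleR_add_left)
    qed
    from generator_fun_le[OF wd 0 this]
    have bound: "real k * ?r \<le> - ?F" for k by (simp add: algebra_simps)
    have "?r \<le> 0"
    proof (rule ccontr)
      assume "\<not> ?r \<le> 0"
      then obtain k where "- ?F < real k * ?r" using reals_Archimedean3[of ?r] by auto
      then show False using bound[of k] by simp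
    qed
    then show "0 \<le> \<alpha> \<bullet> 0 - ?r" by simp
  qed
qed

text \<open>Each generator competes at its own right-hand side, where \<alpha> \<bullet> \<omega>
  cancels the transposed terms and leaves its cost.\<close>

lemma generator_fun_feasible:
  assumes M: "add_submonoid M" and "I \<subseteq> M" and wd: "generator_well_defined A G c d M \<alpha>"
  shows "(\<lambda>\<omega>. real_of_ereal (generator_fun A G c d M \<alpha> \<omega>)) \<in> subadditive_dual_feasible A G c d M I"
proof -
  have "real_of_ereal (generator_fun A G c d M \<alpha> (A *v x + G *v y)) \<le> c \<bullet> x + d \<bullet> y"
    if "(x, y) \<in> I" for x y
  proof -
    have xy: "(x, y) \<in> M_le A G M (A *v x + G *v y)" using that assms by (auto simp: M_le_def)
    then have "A *v x + G *v y \<in> Omega_le A G M" by (auto simp: Omega_le_eq)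
    from generator_fun_le[OF wd this xy] show ?thesis
      by (simp add: inner_add_right inner_diff_left dot_lmul_matrix)
  qed
  then show ?thesis
    using generator_fun_subadditive[OF M wd] generator_fun_zero[OF M wd]
    by (auto simp: subadditive_dual_feasible_def)
qed

section \<open>Optimality via the conic dual\<close>

theorem theorem2:
  fixes M I :: "((real^'n1) \<times> (real^'n2)) set"
    and c :: "real^'n1" and d :: "real^'n2"
    and A :: "real^'n1^'m" and G :: "real^'n2^'m" and b :: "real^'m"
    and P :: "real^'n1^'k" and \<Phi> :: "real^'n2^'k" and \<Psi> :: "real^'n3^'k"
    and \<pi> :: "real^'k" and C :: "(real^'k) set"
  assumes monoid: "add_submonoid M"
    and integer: "\<forall>(x, y)\<in>M. \<forall>j. x $ j \<in> \<int>"
    and generating: "integral_generating_set I M"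
    and feasible: "mip_feasible A G b M \<noteq> {}"
    and well_defined: "\<forall>\<alpha>. generator_well_defined A G c d M \<alpha>"
    and regular: "regular_cone C"
    and conic_representation:
      "convex hull (M_le A G M b) = {(x, y). \<exists>w. (x, y, w) \<in> conic_set P \<Phi> \<Psi> \<pi> C}"
    and strong_conic_dual:
      "strong_dual
         (\<lambda>(x, y, w). c \<bullet> x + d \<bullet> y) (conic_primal_feasible A G b P \<Phi> \<Psi> \<pi> C)
         (\<lambda>(\<alpha>, \<gamma>). b \<bullet> \<alpha> + \<pi> \<bullet> \<gamma>) (conic_dual_feasible A G c d P \<Phi> \<Psi> C)"
  shows "\<exists>\<alpha>. generator_well_defined A G c d M \<alpha> \<and>
    optimal_max_solution (\<lambda>f. f b) (subadditive_dual_feasible A G c d M I)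
      (\<lambda>\<omega>. real_of_ereal (generator_fun A G c d M \<alpha> \<omega>))"
proof -
  define T where "T z = A *v fst z + G *v snd z" for z
  define L where "L z = c \<bullet> fst z + d \<bullet> snd z" for z
  have T: "linear T" unfolding T_def
    by (intro linearI) (simp_all add: matrix_vector_right_distrib algebra_simps)
  have L: "linear L" unfolding L_def
    by (intro linearI) (simp_all add: inner_add_right algebra_simps)
  have b: "b \<in> Omega_le A G M"
    using feasible by (auto simp: Omega_le_eq M_le_def mip_feasible_def)
  \<comment> \<open>Attainment of the strong dual supplies the witness \<alpha>; the vector \<gamma>
    certifies the lower bound \<open>dual_le\<close>.\<close>
  obtain \<alpha> \<gamma> where \<alpha>\<gamma>: "(\<alpha>, \<gamma>) \<in> conic_dual_feasible A G c d P \<Phi> \<Psi> C"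
    and opt: "ereal (b \<bullet> \<alpha> + \<pi> \<bullet> \<gamma>)
      = inf_value (\<lambda>(x, y, w). c \<bullet> x + d \<bullet> y) (conic_primal_feasible A G b P \<Phi> \<Psi> \<pi> C)"
    using strong_conic_dual by (auto simp: strong_dual_def optimal_max_solution_def)
  have wd: "generator_well_defined A G c d M \<alpha>" using well_defined by blast
  define F where "F \<omega> = real_of_ereal (generator_fun A G c d M \<alpha> \<omega>)" for \<omega>
  have I: "I \<subseteq> M" using generating by (simp add: integral_generating_set_def)
  have F: "F \<in> subadditive_dual_feasible A G c d M I"
    using generator_fun_feasible[OF monoid I wd] by (simp add: F_def[abs_def])
  have dual_le: "b \<bullet> \<alpha> + \<pi> \<bullet> \<gamma> \<le> F b"
    unfolding F_def
  proof (rule generator_fun_ge[OF wd b])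
    fix x y assume "(x, y) \<in> M_le A G M b"
    then have "(x, y) \<in> convex hull (M_le A G M b)" by (rule hull_inc)
    \<comment> \<open>The auxiliary \<open>w\<close> drops out after pairing with \<gamma>, because
      \<open>transpose \<Psi> *v \<gamma> = 0\<close>.\<close>
    then obtain w where "P *v x + \<Phi> *v y + \<Psi> *v w - \<pi> \<in> C"
      unfolding conic_representation by (auto simp: conic_set_def)
    then have "0 \<le> (P *v x + \<Phi> *v y + \<Psi> *v w - \<pi>) \<bullet> \<gamma>"
      using \<alpha>\<gamma> by (auto simp: conic_dual_feasible_def dual_cone_def)
    then have "\<pi> \<bullet> \<gamma> \<le> (transpose P *v \<gamma>) \<bullet> x + (transpose \<Phi> *v \<gamma>) \<bullet> y + (transpose \<Psi> *v \<gamma>) \<bullet> w"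
      by (simp add: inner_add_right inner_diff_right dot_lmul_matrix inner_commute[of _ \<gamma>])
    moreover have "transpose \<Psi> *v \<gamma> = 0" "transpose P *v \<gamma> = c - transpose A *v \<alpha>"
      "transpose \<Phi> *v \<gamma> = d - transpose G *v \<alpha>"
      using \<alpha>\<gamma> by (auto simp: conic_dual_feasible_def algebra_simps)
    ultimately show "b \<bullet> \<alpha> + \<pi> \<bullet> \<gamma>
        \<le> \<alpha> \<bullet> b - ((transpose A *v \<alpha> - c) \<bullet> x + (transpose G *v \<alpha> - d) \<bullet> y)"
      by (simp add: inner_diff_left inner_commute[of b])
  qed
  have le_dual: "f b \<le> b \<bullet> \<alpha> + \<pi> \<bullet> \<gamma>" if f: "f \<in> subadditive_dual_feasible A G c d M I" for f
  proof -
    have M_ge: "f (T z) \<le> L z" if "z \<in> M" for z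
    proof (rule integral_generating_set_subadditive_le[OF monoid generating T L _ _ _ _ that])
      show "T ` M \<subseteq> Omega_le A G M"
        by (auto simp: T_def Omega_le_def)
      show "subadditive_on (Omega_le A G M) f" "f 0 \<le> 0"
        using f by (auto simp: subadditive_dual_feasible_def)
      show "f (T u) \<le> L u" if "u \<in> I" for u
        using f that by (auto simp: subadditive_dual_feasible_def T_def L_def)
    qed
    have "f b \<le> c \<bullet> x + d \<bullet> y" if xyw: "(x, y, w) \<in> conic_primal_feasible A G b P \<Phi> \<Psi> \<pi> C" for x y w
    proof -
      have "(x, y) \<in> convex hull (M_le A G M b)"
        unfolding conic_representation using xyw by (auto simp: conic_primal_feasible_def)
      moreover have "M_le A G M b = {z \<in> M. T z \<le> b}" by (auto simp: M_le_def T_def)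
      moreover have "T (x, y) = b" using xyw by (simp add: T_def conic_primal_feasible_def)
      ultimately have "(x, y) \<in> convex hull {z \<in> M. T z = b}"
        using convex_hull_equality_face[OF T] by simp
      moreover have "convex hull {z \<in> M. T z = b} \<subseteq> L -` {f b..}"
        using M_ge by (intro hull_minimal convex_linear_vimage[OF L]) auto
      ultimately show ?thesis by (auto simp: L_def)
    qed
    then have "ereal (f b)
        \<le> inf_value (\<lambda>(x, y, w). c \<bullet> x + d \<bullet> y) (conic_primal_feasible A G b P \<Phi> \<Psi> \<pi> C)"
      unfolding inf_value_def by (intro INF_greatest) auto
    then show ?thesis by (simp flip: opt)
  qed
  have "ereal (F b) = sup_value (\<lambda>f. f b) (subadditive_dual_feasible A G c d M I)"
    unfolding sup_value_def
  proof (rule antisym)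
    show "ereal (F b) \<le> (SUP f\<in>subadditive_dual_feasible A G c d M I. ereal (f b))"
      using F by (rule SUP_upper)
    \<comment> \<open>The optimal conic dual value separates every feasible \<open>f b\<close> from
      \<open>F b\<close>.\<close>
    show "(SUP f\<in>subadditive_dual_feasible A G c d M I. ereal (f b)) \<le> ereal (F b)"
      using le_dual dual_le by (intro SUP_least) (auto intro: order_trans)
  qed
  then show ?thesis
    using wd F by (auto simp: optimal_max_solution_def F_def[abs_def])
qed

end
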